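(* There is an algorithm which, given a finite simple graph $G=(V,E)$, decides in linear time, i.e. in time $O(|V|+|E|)$, whether there exist $k\ge 1$ and positive integers $p_1,\dots,p_k$ such that $G\in G_{p_1,\dots,p_k}$.
   Context: All graphs are finite and simple. Two graphs are degree-equivalent if they have the same degree sequence. For positive integers $p_1,\dots,p_k$, $G_{p_1,\dots,p_k}$ denotes the class of all simple graphs that are degree-equivalent to, but different from (not isomorphic to), the disjoint union of cliques $K_{p_1}\cup\dots\cup K_{p_k}$, where $K_p$ is the complete graph on $p$ vertices. *)

theory Defs
  imports "HOL-Library.Multiset"
begin

record 'a graph =
  verts :: "'a set"
  edges :: "'a set set"

definition simple_graph :: "'a graph \<Rightarrow> bool" where
  "simple_graph G \<longleftrightarrow> finite (verts G) \<and> (\<forall>e\<in>edges G. e \<subseteq> verts G \<and> card e = 2)"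

definition vertex_degree :: "'a graph \<Rightarrow> 'a \<Rightarrow> nat" where
  "vertex_degree G v = card {e \<in> edges G. v \<in> e}"

definition degree_sequence :: "'a graph \<Rightarrow> nat list" where
  "degree_sequence G =
     rev (sorted_list_of_multiset (image_mset (vertex_degree G) (mset_set (verts G))))"

definition degree_equivalent :: "'a graph \<Rightarrow> 'b graph \<Rightarrow> bool" where
  "degree_equivalent G H \<longleftrightarrow> degree_sequence G = degree_sequence H"

definition isomorphic :: "'a graph \<Rightarrow> 'b graph \<Rightarrow> bool" where
  "isomorphic G H \<longleftrightarrow>
     (\<exists>f. bij_betw f (verts G) (verts H) \<and>
          (\<forall>u\<in>verts G. \<forall>v\<in>verts G. {u, v} \<in> edges G \<longleftrightarrow> {f u, f v} \<in> edges H))"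

definition complete_graph :: "nat \<Rightarrow> nat graph" where
  "complete_graph p = \<lparr>verts = {0..<p}, edges = {{u, v} | u v. u < p \<and> v < p \<and> u \<noteq> v}\<rparr>"

definition disjoint_union :: "'a graph list \<Rightarrow> (nat \<times> 'a) graph" where
  "disjoint_union Gs =
     \<lparr>verts = {(i, v). i < length Gs \<and> v \<in> verts (Gs ! i)},
      edges = {Pair i ` e | i e. i < length Gs \<and> e \<in> edges (Gs ! i)}\<rparr>"

text \<open>The class written \<open>G\<close> with index \<open>p\<^sub>1, \<dots>, p\<^sub>k\<close>, for the list \<open>ps\<close> of the \<open>p\<^sub>i\<close>.\<close>

definition clique_degree_class :: "nat list \<Rightarrow> 'a graph set" where
  "clique_degree_class ps =
     {G. simple_graph G \<and>
         degree_equivalent G (disjoint_union (map complete_graph ps)) \<and>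
         \<not> isomorphic G (disjoint_union (map complete_graph ps))}"

text \<open>
  The model of computation is the unit-cost random access machine with addition and (truncated)
  subtraction, but no multiplication, as its only arithmetic. Every instruction takes one time
  step. Registers are addressed directly, so that a program uses only finitely many of them;
  memory is accessed through an address held in a register. Jump targets are absolute. The machine
  has halted once the program counter lies outside the program.
\<close>

datatype instr =
    Const nat nat      \<comment> \<open>\<open>r\<^sub>i := k\<close>\<close>
  | Add nat nat nat    \<comment> \<open>\<open>r\<^sub>i := r\<^sub>j + r\<^sub>k\<close>\<close>
  | Sub nat nat nat    \<comment> \<open>\<open>r\<^sub>i := r\<^sub>j - r\<^sub>k\<close>\<close>
  | Load nat nat       \<comment> \<open>\<open>r\<^sub>i := mem[r\<^sub>j]\<close>\<close>
  | Store nat nat      \<comment> \<open>\<open>mem[r\<^sub>i] := r\<^sub>j\<close>\<close>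
  | Jump nat
  | JumpZero nat nat   \<comment> \<open>jump to \<open>l\<close> if \<open>r\<^sub>i = 0\<close>\<close>

record config =
  pc :: nat
  reg :: "nat \<Rightarrow> nat"
  mem :: "nat \<Rightarrow> nat"

fun exec :: "instr \<Rightarrow> config \<Rightarrow> config" where
  "exec (Const i k) c = c\<lparr>pc := pc c + 1, reg := (reg c)(i := k)\<rparr>"
| "exec (Add i j k) c = c\<lparr>pc := pc c + 1, reg := (reg c)(i := reg c j + reg c k)\<rparr>"
| "exec (Sub i j k) c = c\<lparr>pc := pc c + 1, reg := (reg c)(i := reg c j - reg c k)\<rparr>"
| "exec (Load i j) c = c\<lparr>pc := pc c + 1, reg := (reg c)(i := mem c (reg c j))\<rparr>"
| "exec (Store i j) c = c\<lparr>pc := pc c + 1, mem := (mem c)(reg c i := reg c j)\<rparr>"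
| "exec (Jump l) c = c\<lparr>pc := l\<rparr>"
| "exec (JumpZero i l) c = c\<lparr>pc := (if reg c i = 0 then l else pc c + 1)\<rparr>"

definition halted :: "instr list \<Rightarrow> config \<Rightarrow> bool" where
  "halted P c \<longleftrightarrow> length P \<le> pc c"

definition step :: "instr list \<Rightarrow> config \<Rightarrow> config" where
  "step P c = (if halted P c then c else exec (P ! pc c) c)"

definition initial :: "nat list \<Rightarrow> config" where
  "initial xs =
     \<lparr>pc = 0, reg = (\<lambda>_. 0), mem = (\<lambda>a. if a < length xs then xs ! a else 0)\<rparr>"

text \<open>
  On input \<open>xs\<close> the program \<open>P\<close> halts after at most \<open>t\<close> steps (halted configurations are fixed
  points of \<^const>\<open>step\<close>) with the truth value \<open>b\<close>, as \<open>0\<close> or \<open>1\<close>, in register \<open>0\<close>.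
\<close>

definition answers_within :: "instr list \<Rightarrow> nat list \<Rightarrow> nat \<Rightarrow> bool \<Rightarrow> bool" where
  "answers_within P xs t b \<longleftrightarrow>
     (let c = (step P ^^ t) (initial xs) in halted P c \<and> reg c 0 = (if b then 1 else 0))"

text \<open>
  A graph with \<open>n\<close> vertices and \<open>m\<close> edges is presented as \<open>n, m, u\<^sub>1, v\<^sub>1, \<dots>, u\<^sub>m, v\<^sub>m\<close>: the vertices
  are numbered \<open>0, \<dots>, n - 1\<close> by an arbitrary bijection \<open>f\<close>, and each edge is listed once, in
  arbitrary order and with its endpoints in arbitrary order. Such a list can be read off from
  adjacency lists in linear time.
\<close>

definition encodes :: "nat list \<Rightarrow> 'a graph \<Rightarrow> bool" where
  "encodes xs G \<longleftrightarrow>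
     (\<exists>f es. bij_betw f (verts G) {0..<card (verts G)} \<and>
             distinct (map (\<lambda>(u, v). {u, v}) es) \<and>
             set (map (\<lambda>(u, v). {u, v}) es) = (\<lambda>e. f ` e) ` edges G \<and>
             xs = card (verts G) # length es # concat (map (\<lambda>(u, v). [u, v]) es))"

text \<open>
  Vertices are natural numbers, which covers all finite graphs up to isomorphism; with a type
  variable instead, the program could depend on its instance. The summand \<open>1\<close> only matters for
  the graph without vertices.
\<close>

definition decides_in_linear_time :: "instr list \<Rightarrow> (nat graph \<Rightarrow> bool) \<Rightarrow> bool" where
  "decides_in_linear_time P Q \<longleftrightarrow>
     (\<exists>c. \<forall>G xs. simple_graph G \<longrightarrow> encodes xs G \<longrightarrow>
        answers_within P xs (c * (card (verts G) + card (edges G) + 1)) (Q G))"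

end

theory Submission
  imports Defs
begin

text \<open>
  Write \<open>n\<^sub>d\<close> for the number of vertices of degree \<open>d\<close>. A clique on \<open>d + 1\<close> vertices contributes
  \<open>d + 1\<close> vertices of degree \<open>d\<close>, so \<open>G\<close> is degree-equivalent to some union of cliques iff \<open>d + 1\<close>
  divides \<open>n\<^sub>d\<close> for every \<open>d\<close>; the clique sizes are then determined up to order. If \<open>G\<close> itself is a
  union of cliques, it is isomorphic to that one, because such graphs are determined up to
  isomorphism by their degrees. Hence \<open>G\<close> lies in one of the classes iff all these divisibilities
  hold and \<open>G\<close> is not a union of cliques (\<open>in_clique_degree_class_iff\<close>). The graph without vertices
  is rejected by the second condition.

  Both conditions can be tested in linear time from the list of edges alone. For the second,
  let \<open>t(v)\<close> be the largest number of a vertex in the closed neighbourhood of \<open>v\<close>. Then \<open>G\<close>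
  is a union of cliques iff the two ends of each edge agree in degree and in \<open>t\<close>
  (\<open>cluster_iff_local_test\<close>): if they do, the vertex with number \<open>t(v)\<close> is a hub whose closed
  neighbourhood contains that of \<open>v\<close>, and equality of degrees turns the inclusion into equality.
  For the first, it suffices to keep for each \<open>d\<close> a counter modulo \<open>d + 1\<close>, which needs no
  division, and the sum of all counters.

  The program therefore makes three passes: over the edges to compute degrees and \<open>t\<close>, over the
  edges again to accumulate the disagreements, and over the vertices to update the counters. Each
  pass is a loop with a body of constant cost (\<open>record_loop\<close>, \<open>compare_loop\<close>, \<open>tally_loop\<close>), and
  \<open>decider_correct\<close> combines them. The locale \<open>encoding\<close> translates between the graph and its
  list of edges.
\<close>

section \<open>Disjoint unions of cliques as graphs with transitive adjacency\<close>

definition cluster :: "'a graph \<Rightarrow> bool" where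
  "cluster G \<longleftrightarrow>
     (\<forall>u v w. {u, v} \<in> edges G \<longrightarrow> {v, w} \<in> edges G \<longrightarrow> u \<noteq> w \<longrightarrow> {u, w} \<in> edges G)"

definition closed_nbhd :: "'a graph \<Rightarrow> 'a \<Rightarrow> 'a set" where
  "closed_nbhd G v = insert v {u. {u, v} \<in> edges G}"

lemma edgeD:
  assumes "simple_graph G" "{u, v} \<in> edges G"
  shows "u \<in> verts G" "v \<in> verts G" "u \<noteq> v"
  using assms by (auto simp: simple_graph_def card_2_iff doubleton_eq_iff)

lemma edge_cases:
  assumes "simple_graph G" "e \<in> edges G"
  obtains u v where "e = {u, v}" "u \<noteq> v" "u \<in> verts G" "v \<in> verts G"
  using assms by (auto simp: simple_graph_def card_2_iff)

lemma closed_nbhd_subset: "simple_graph G \<Longrightarrow> v \<in> verts G \<Longrightarrow> closed_nbhd G v \<subseteq> verts G"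
  by (auto simp: closed_nbhd_def dest: edgeD)

lemma finite_closed_nbhd: "simple_graph G \<Longrightarrow> v \<in> verts G \<Longrightarrow> finite (closed_nbhd G v)"
  using closed_nbhd_subset finite_subset by (fastforce simp: simple_graph_def)

lemma card_closed_nbhd:
  assumes G: "simple_graph G" and v: "v \<in> verts G"
  shows "card (closed_nbhd G v) = Suc (vertex_degree G v)"
proof -
  have fin: "finite {u. {u, v} \<in> edges G}"
    using finite_closed_nbhd[OF G v] by (simp add: closed_nbhd_def)
  have inj: "inj_on (\<lambda>u. {u, v}) {u. {u, v} \<in> edges G}"
    by (auto simp: inj_on_def doubleton_eq_iff)
  have "(\<lambda>u. {u, v}) ` {u. {u, v} \<in> edges G} = {e \<in> edges G. v \<in> e}"
  proof
    show "{e \<in> edges G. v \<in> e} \<subseteq> (\<lambda>u. {u, v}) ` {u. {u, v} \<in> edges G}"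
    proof clarify
      fix e assume e: "e \<in> edges G" "v \<in> e"
      obtain x y where "e = {x, y}" using edge_cases[OF G e(1)] by blast
      with e have "e = {(if x = v then y else x), v}" by auto
      with e show "e \<in> (\<lambda>u. {u, v}) ` {u. {u, v} \<in> edges G}"
        by (intro image_eqI[of _ _ "if x = v then y else x"]) auto
    qed
  qed auto
  then have "vertex_degree G v = card {u. {u, v} \<in> edges G}"
    unfolding vertex_degree_def using card_image[OF inj] by simp
  moreover have "v \<notin> {u. {u, v} \<in> edges G}" using edgeD(3)[OF G] by blast
  ultimately show ?thesis using fin by (simp add: closed_nbhd_def)
qed

lemma closed_nbhd_eq_iff_cluster:
  assumes G: "simple_graph G" and cl: "cluster G"
  shows "closed_nbhd G u = closed_nbhd G v \<longleftrightarrow> u = v \<or> {u, v} \<in> edges G"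
proof
  assume "closed_nbhd G u = closed_nbhd G v"
  then show "u = v \<or> {u, v} \<in> edges G" by (auto simp: closed_nbhd_def)
next
  have sub: "closed_nbhd G u \<subseteq> closed_nbhd G v" if uv: "{u, v} \<in> edges G" for u v
  proof
    fix x assume "x \<in> closed_nbhd G u"
    then have "x = u \<or> {x, u} \<in> edges G" by (simp add: closed_nbhd_def)
    then have "x = v \<or> {x, v} \<in> edges G" using uv cl unfolding cluster_def by blast
    then show "x \<in> closed_nbhd G v" by (simp add: closed_nbhd_def)
  qed
  assume "u = v \<or> {u, v} \<in> edges G"
  then show "closed_nbhd G u = closed_nbhd G v"
    using sub[of u v] sub[of v u] by (auto simp: insert_commute)
qed

text \<open>
  The maximum only serves to choose one element of the closed neighbourhood \<open>N[v]\<close> as a function of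
  the set \<open>N[v]\<close>. In a union of cliques the ends of an edge have the same closed neighbourhood, hence
  the same choice. Conversely, let \<open>r\<close> be chosen for \<open>u\<close>. All \<open>x\<close> in \<open>N[u]\<close> choose \<open>r\<close> as well, so
  they lie in \<open>N[r]\<close>. Thus \<open>N[u] \<subseteq> N[r]\<close>, with equality as the degrees agree.
\<close>

lemma cluster_iff_local_test:
  fixes f :: "'a \<Rightarrow> nat"
  assumes G: "simple_graph G" and f: "inj_on f (verts G)"
  shows "cluster G \<longleftrightarrow> (\<forall>u v. {u, v} \<in> edges G \<longrightarrow>
           vertex_degree G u = vertex_degree G v \<and>
           Max (f ` closed_nbhd G u) = Max (f ` closed_nbhd G v))" (is "_ \<longleftrightarrow> ?R")
proof
  assume "cluster G"
  then show ?R
    using closed_nbhd_eq_iff_cluster[OF G] card_closed_nbhd[OF G] edgeD[OF G]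
    by (metis Suc_inject)
next
  assume R: ?R
  have hub: "\<exists>r\<in>verts G. f r = Max (f ` closed_nbhd G u) \<and> closed_nbhd G u = closed_nbhd G r"
    if u: "u \<in> verts G" for u
  proof -
    have "Max (f ` closed_nbhd G u) \<in> f ` closed_nbhd G u"
      using finite_closed_nbhd[OF G u] by (intro Max_in) (auto simp: closed_nbhd_def)
    then obtain r where r: "r \<in> closed_nbhd G u" "f r = Max (f ` closed_nbhd G u)" by auto
    have rV: "r \<in> verts G" using closed_nbhd_subset[OF G u] r(1) by blast
    have deg: "vertex_degree G r = vertex_degree G u"
      using r(1) R by (auto simp: closed_nbhd_def)
    have "closed_nbhd G u \<subseteq> closed_nbhd G r"
    proof
      fix x assume x: "x \<in> closed_nbhd G u"
      then have xV: "x \<in> verts G" using closed_nbhd_subset[OF G u] by blast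
      have "Max (f ` closed_nbhd G x) = f r"
        using x r(2) R by (auto simp: closed_nbhd_def)
      moreover have "Max (f ` closed_nbhd G x) \<in> f ` closed_nbhd G x"
        using finite_closed_nbhd[OF G xV] by (intro Max_in) (auto simp: closed_nbhd_def)
      ultimately obtain s where s: "s \<in> closed_nbhd G x" "f s = f r" by auto
      then have "s = r"
        using f rV closed_nbhd_subset[OF G xV] by (auto simp: inj_on_def)
      with s(1) show "x \<in> closed_nbhd G r" by (auto simp: closed_nbhd_def insert_commute)
    qed
    then have "closed_nbhd G u = closed_nbhd G r"
      using card_subset_eq[OF finite_closed_nbhd[OF G rV]] card_closed_nbhd[OF G] u rV deg by simp
    then show ?thesis using rV r(2) by blast
  qed
  have same: "closed_nbhd G u = closed_nbhd G v" if uv: "{u, v} \<in> edges G" for u v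
  proof -
    obtain r s where "r \<in> verts G" "f r = Max (f ` closed_nbhd G u)"
        "closed_nbhd G u = closed_nbhd G r"
      and "s \<in> verts G" "f s = Max (f ` closed_nbhd G v)" "closed_nbhd G v = closed_nbhd G s"
      using hub edgeD[OF G uv] by metis
    moreover have "Max (f ` closed_nbhd G u) = Max (f ` closed_nbhd G v)" using R uv by blast
    ultimately show ?thesis using inj_onD[OF f, of r s] by simp
  qed
  show "cluster G"
    unfolding cluster_def
  proof (intro allI impI)
    fix u v w assume uv: "{u, v} \<in> edges G" and vw: "{v, w} \<in> edges G" and "u \<noteq> w"
    have "closed_nbhd G u = closed_nbhd G w" using same[OF uv] same[OF vw] by simp
    then have "u \<in> closed_nbhd G w" by (auto simp: closed_nbhd_def)
    with \<open>u \<noteq> w\<close> show "{u, w} \<in> edges G" by (simp add: closed_nbhd_def)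
  qed
qed

text \<open>
  The functions \<open>\<alpha>\<close> and \<open>\<beta>\<close> stand for partitions into their fibres. Two partitions with the same
  multiset of block sizes, each size counted once per element of the block, are isomorphic: match a
  block of \<open>A\<close> with one of the same size in \<open>B\<close>, remove both, and continue. The removal does not
  change the sizes of the other blocks.
\<close>

lemma partition_isomorphism:
  fixes \<alpha> :: "'a \<Rightarrow> 'c" and \<beta> :: "'b \<Rightarrow> 'd"
  assumes "finite A" "finite B"
    and "image_mset (\<lambda>v. card {u\<in>A. \<alpha> u = \<alpha> v}) (mset_set A) =
         image_mset (\<lambda>w. card {u\<in>B. \<beta> u = \<beta> w}) (mset_set B)"
  shows "\<exists>f. bij_betw f A B \<and> (\<forall>u\<in>A. \<forall>v\<in>A. \<alpha> u = \<alpha> v \<longleftrightarrow> \<beta> (f u) = \<beta> (f v))"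
  using assms
proof (induction "card A" arbitrary: A B rule: less_induct)
  case less
  let ?a = "\<lambda>A v. card {u\<in>A. \<alpha> u = \<alpha> v}" and ?b = "\<lambda>B w. card {u\<in>B. \<beta> u = \<beta> w}"
  show ?case
  proof (cases "A = {}")
    case True
    then have "B = {}" using less.prems by (auto simp: mset_set_empty_iff)
    with True show ?thesis by (auto simp: bij_betw_def)
  next
    case False
    then obtain v where v: "v \<in> A" by blast
    have "?a A v \<in># image_mset (?a A) (mset_set A)" using v less.prems(1) by simp
    then have "?a A v \<in># image_mset (?b B) (mset_set B)" by (simp only: less.prems(3))
    then obtain w where w: "w \<in> B" "?a A v = ?b B w" using less.prems(2) by auto
    define C where "C = {u\<in>A. \<alpha> u = \<alpha> v}"
    define D where "D = {u\<in>B. \<beta> u = \<beta> w}"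
    have C: "C \<subseteq> A" "finite C" "v \<in> C" and D: "D \<subseteq> B" "finite D"
      using v less.prems by (auto simp: C_def D_def)
    have CD: "card C = card D" using w by (simp add: C_def D_def)
    have splitA: "mset_set A = mset_set C + mset_set (A - C)"
      using C less.prems(1) mset_set_Union[of C "A - C"] by (simp add: Un_absorb1)
    have splitB: "mset_set B = mset_set D + mset_set (B - D)"
      using D less.prems(2) mset_set_Union[of D "B - D"] by (simp add: Un_absorb1)
    have "image_mset (?a A) (mset_set C) = image_mset (\<lambda>_. card C) (mset_set C)"
      using C by (intro image_mset_cong) (auto simp: C_def)
    moreover have "image_mset (?b B) (mset_set D) = image_mset (\<lambda>_. card C) (mset_set D)"
      using D by (intro image_mset_cong) (auto simp: D_def w(2) C_def)
    moreover have "image_mset (\<lambda>_. card C) (mset_set C) = image_mset (\<lambda>_. card C) (mset_set D)"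
      using CD by (simp add: image_mset_const_eq)
    moreover have "image_mset (?a A) (mset_set (A - C)) = image_mset (?a (A - C)) (mset_set (A - C))"
      using less.prems(1) by (intro image_mset_cong arg_cong[where f = card]) (auto simp: C_def)
    moreover have "image_mset (?b B) (mset_set (B - D)) = image_mset (?b (B - D)) (mset_set (B - D))"
      using less.prems(2) by (intro image_mset_cong arg_cong[where f = card]) (auto simp: D_def)
    ultimately have "image_mset (?a (A - C)) (mset_set (A - C)) =
        image_mset (?b (B - D)) (mset_set (B - D))"
      using less.prems(3) by (simp add: splitA splitB)
    moreover have "card (A - C) < card A"
      using C less.prems(1) v by (intro psubset_card_mono) auto
    ultimately obtain g where g: "bij_betw g (A - C) (B - D)"
        "\<forall>u\<in>A - C. \<forall>v\<in>A - C. \<alpha> u = \<alpha> v \<longleftrightarrow> \<beta> (g u) = \<beta> (g v)"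
      using less.hyps[of "A - C" "B - D"] less.prems by auto
    obtain h where h: "bij_betw h C D"
      using finite_same_card_bij[OF C(2) D(2) CD] by blast
    define f where "f = (\<lambda>u. if u \<in> C then h u else g u)"
    have fC: "bij_betw f C D" using h by (simp add: f_def cong: bij_betw_cong)
    have fA: "bij_betw f (A - C) (B - D)"
      using g(1) by (subst bij_betw_cong[of _ _ g]) (auto simp: f_def)
    have "bij_betw f (C \<union> (A - C)) (D \<union> (B - D))"
      using fC fA by (rule bij_betw_combine) auto
    moreover have "C \<union> (A - C) = A" "D \<union> (B - D) = B" using C D by auto
    ultimately have bij: "bij_betw f A B" by simp
    have inD: "\<beta> (f u) = \<beta> w \<longleftrightarrow> u \<in> C" if "u \<in> A" for u
      using fC fA that unfolding bij_betw_def D_def by blast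
    have "\<alpha> x = \<alpha> y \<longleftrightarrow> \<beta> (f x) = \<beta> (f y)" if "x \<in> A" "y \<in> A" for x y
    proof (cases "x \<in> C \<or> y \<in> C")
      case True
      then show ?thesis using inD[of x] inD[of y] that by (auto simp: C_def)
    next
      case False
      then show ?thesis using g(2) that by (simp add: f_def)
    qed
    with bij show ?thesis by blast
  qed
qed

lemma degree_equivalent_iff:
  "degree_equivalent G H \<longleftrightarrow>
     image_mset (vertex_degree G) (mset_set (verts G)) =
     image_mset (vertex_degree H) (mset_set (verts H))"
  unfolding degree_equivalent_def degree_sequence_def
  by (metis mset_sorted_list_of_multiset rev_rev_ident)

lemma cluster_class_sizes:
  assumes G: "simple_graph G" and cl: "cluster G"
  shows "image_mset (\<lambda>v. card {u\<in>verts G. closed_nbhd G u = closed_nbhd G v}) (mset_set (verts G)) =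
    image_mset Suc (image_mset (vertex_degree G) (mset_set (verts G)))"
  unfolding multiset.map_comp
proof (rule image_mset_cong)
  fix v assume "v \<in># mset_set (verts G)"
  then have v: "v \<in> verts G" using G by (simp add: simple_graph_def)
  have "{u\<in>verts G. closed_nbhd G u = closed_nbhd G v} = closed_nbhd G v"
    using closed_nbhd_eq_iff_cluster[OF G cl] closed_nbhd_subset[OF G v] v
    by (auto simp: closed_nbhd_def)
  then show "card {u\<in>verts G. closed_nbhd G u = closed_nbhd G v} = (Suc \<circ> vertex_degree G) v"
    using card_closed_nbhd[OF G v] by simp
qed

text \<open>
  The cliques are the fibres of the closed neighbourhood, and the one of a vertex of degree \<open>d\<close> has
  \<open>d + 1\<close> elements.
\<close>

lemma clusters_isomorphic:
  assumes G: "simple_graph G" "cluster G" and H: "simple_graph H" "cluster H"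
    and deg: "degree_equivalent G H"
  shows "isomorphic G H"
proof -
  obtain f where f: "bij_betw f (verts G) (verts H)"
      "\<forall>u\<in>verts G. \<forall>v\<in>verts G. closed_nbhd G u = closed_nbhd G v \<longleftrightarrow>
         closed_nbhd H (f u) = closed_nbhd H (f v)"
    using partition_isomorphism[of "verts G" "verts H" "closed_nbhd G" "closed_nbhd H"]
      cluster_class_sizes[OF G] cluster_class_sizes[OF H] deg G(1) H(1)
    unfolding degree_equivalent_iff simple_graph_def by auto
  have "{u, v} \<in> edges G \<longleftrightarrow> {f u, f v} \<in> edges H" if uv: "u \<in> verts G" "v \<in> verts G" for u v
  proof -
    have "u = v \<longleftrightarrow> f u = f v" using f(1) uv by (auto simp: bij_betw_def inj_on_def)
    moreover have "u = v \<or> {u, v} \<in> edges G \<longleftrightarrow> f u = f v \<or> {f u, f v} \<in> edges H"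
      using f(2) uv closed_nbhd_eq_iff_cluster[OF G, of u v]
        closed_nbhd_eq_iff_cluster[OF H, of "f u" "f v"] by simp
    ultimately show ?thesis using edgeD(3)[OF G(1)] edgeD(3)[OF H(1)] by blast
  qed
  with f(1) show ?thesis unfolding isomorphic_def by blast
qed

lemma cluster_if_isomorphic:
  assumes G: "simple_graph G" and H: "simple_graph H" "cluster H" and "isomorphic G H"
  shows "cluster G"
proof -
  obtain f where f: "bij_betw f (verts G) (verts H)"
      "\<forall>u\<in>verts G. \<forall>v\<in>verts G. {u, v} \<in> edges G \<longleftrightarrow> {f u, f v} \<in> edges H"
    using assms(4) unfolding isomorphic_def by blast
  show ?thesis
    unfolding cluster_def
  proof (intro allI impI)
    fix u v w assume uv: "{u, v} \<in> edges G" and vw: "{v, w} \<in> edges G" and ne: "u \<noteq> w"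
    note V = edgeD[OF G uv] edgeD[OF G vw]
    have "f u \<noteq> f w" using f(1) V ne by (auto simp: bij_betw_def inj_on_def)
    moreover have "{f u, f v} \<in> edges H" "{f v, f w} \<in> edges H" using f(2) V uv vw by blast+
    ultimately have "{f u, f w} \<in> edges H" using H(2) unfolding cluster_def by blast
    then show "{u, w} \<in> edges G" using f(2) V by blast
  qed
qed

section \<open>Membership in the degree classes\<close>

abbreviation cliques :: "nat list \<Rightarrow> (nat \<times> nat) graph" where
  "cliques ps \<equiv> disjoint_union (map complete_graph ps)"

lemma verts_cliques: "verts (cliques ps) = (SIGMA i:{..<length ps}. {..<ps ! i})"
  by (auto simp: disjoint_union_def complete_graph_def)

lemma edge_cliques_iff:
  "{x, y} \<in> edges (cliques ps) \<longleftrightarrow>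
     x \<in> verts (cliques ps) \<and> y \<in> verts (cliques ps) \<and> fst x = fst y \<and> x \<noteq> y"
proof
  assume "{x, y} \<in> edges (cliques ps)"
  then obtain i u v where i: "i < length ps" "u < ps ! i" "v < ps ! i" "u \<noteq> v"
      "{x, y} = Pair i ` {u, v}"
    by (auto simp: disjoint_union_def complete_graph_def)
  then have "x = (i, u) \<and> y = (i, v) \<or> x = (i, v) \<and> y = (i, u)"
    by (simp add: doubleton_eq_iff)
  with i show "x \<in> verts (cliques ps) \<and> y \<in> verts (cliques ps) \<and> fst x = fst y \<and> x \<noteq> y"
    by (auto simp: verts_cliques)
next
  assume *: "x \<in> verts (cliques ps) \<and> y \<in> verts (cliques ps) \<and> fst x = fst y \<and> x \<noteq> y"
  then obtain i u v where i: "x = (i, u)" "y = (i, v)" "i < length ps" "u < ps ! i" "v < ps ! i"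
      "u \<noteq> v"
    by (cases x, cases y) (auto simp: verts_cliques)
  then have "{x, y} = Pair i ` {u, v} \<and> i < length (map complete_graph ps) \<and>
      {u, v} \<in> edges (map complete_graph ps ! i)"
    by (auto simp: complete_graph_def)
  then show "{x, y} \<in> edges (cliques ps)" unfolding disjoint_union_def by auto
qed

lemma simple_graph_cliques: "simple_graph (cliques ps)"
  unfolding simple_graph_def
proof (intro conjI ballI)
  show "finite (verts (cliques ps))" by (simp add: verts_cliques)
  fix e assume e: "e \<in> edges (cliques ps)"
  then obtain x y where xy: "e = {x, y}"
    by (auto simp: disjoint_union_def complete_graph_def)
  with e show "e \<subseteq> verts (cliques ps)" "card e = 2" by (simp_all add: edge_cliques_iff)
qed

lemma cluster_cliques: "cluster (cliques ps)"
  by (auto simp: cluster_def edge_cliques_iff)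

lemma vertex_degree_cliques:
  assumes x: "x \<in> verts (cliques ps)"
  shows "Suc (vertex_degree (cliques ps) x) = ps ! fst x"
proof -
  obtain i a where i: "x = (i, a)" "i < length ps" "a < ps ! i" using x by (auto simp: verts_cliques)
  have "closed_nbhd (cliques ps) x = Pair i ` {..<ps ! i}"
    using i by (auto simp: closed_nbhd_def edge_cliques_iff verts_cliques)
  then have "card (closed_nbhd (cliques ps) x) = ps ! i"
    by (simp add: card_image inj_on_def)
  then show ?thesis using card_closed_nbhd[OF simple_graph_cliques x] i by simp
qed

abbreviation degree_count :: "'a graph \<Rightarrow> nat \<Rightarrow> nat" where
  "degree_count G d \<equiv> card {v \<in> verts G. vertex_degree G v = d}"

lemma count_degrees:
  "simple_graph G \<Longrightarrow>
    count (image_mset (vertex_degree G) (mset_set (verts G))) d = degree_count G d"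
  by (simp add: simple_graph_def count_image_mset' eq_commute[of d])

lemma degree_equivalent_iff_count:
  assumes "simple_graph G" "simple_graph H"
  shows "degree_equivalent G H \<longleftrightarrow> (\<forall>d. degree_count G d = degree_count H d)"
  using assms by (simp add: degree_equivalent_iff multiset_eq_iff count_degrees)

lemma degree_count_cliques: "degree_count (cliques ps) d = Suc d * count (mset ps) (Suc d)"
proof -
  have "{x \<in> verts (cliques ps). vertex_degree (cliques ps) x = d} =
      (SIGMA i:{i. i < length ps \<and> ps ! i = Suc d}. {..<Suc d})" (is "?L = ?R")
  proof -
    have "vertex_degree (cliques ps) x = d \<longleftrightarrow> ps ! fst x = Suc d" if "x \<in> verts (cliques ps)" for x
      using vertex_degree_cliques[OF that] by auto
    then have "?L = {x \<in> verts (cliques ps). ps ! fst x = Suc d}" by auto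
    also have "\<dots> = ?R" by (auto simp: verts_cliques)
    finally show ?thesis .
  qed
  moreover have "card {i. i < length ps \<and> ps ! i = Suc d} = count (mset ps) (Suc d)"
    by (simp add: count_mset count_list_eq_length_filter length_filter_conv_card eq_commute)
  ultimately show ?thesis by (simp add: card_cartesian_product)
qed

text \<open>
  Given the divisibilities, the required multiset of clique sizes contains \<open>d + 1\<close> exactly
  \<open>n\<^sub>d div (d + 1)\<close> times. It is nonempty because a graph that is not a union of cliques has an edge.
\<close>

lemma in_clique_degree_class_iff:
  assumes G: "simple_graph G"
  shows "(\<exists>ps. length ps \<ge> 1 \<and> (\<forall>p\<in>set ps. p > 0) \<and> G \<in> clique_degree_class ps) \<longleftrightarrow>
           (\<forall>d. Suc d dvd degree_count G d) \<and> \<not> cluster G" (is "?L \<longleftrightarrow> ?R")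
proof
  assume ?L
  then obtain ps where deg: "degree_equivalent G (cliques ps)" and iso: "\<not> isomorphic G (cliques ps)"
    by (auto simp: clique_degree_class_def)
  have "Suc d dvd degree_count G d" for d
  proof -
    have "degree_count G d = degree_count (cliques ps) d"
      using deg degree_equivalent_iff_count[OF G simple_graph_cliques] by blast
    then show ?thesis unfolding degree_count_cliques by (simp del: mult_Suc)
  qed
  moreover have "\<not> cluster G"
    using clusters_isomorphic[OF G _ simple_graph_cliques cluster_cliques deg] iso by blast
  ultimately show ?R by blast
next
  assume R: ?R
  have finG: "finite (verts G)" using G by (simp add: simple_graph_def)
  \<comment> \<open>The value at \<open>0\<close> is what makes all clique sizes positive.\<close>
  define M where "M = Abs_multiset (\<lambda>p. if p = 0 then 0 else degree_count G (p - 1) div p)"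
  have "{p. 0 < (if p = 0 then 0 else degree_count G (p - 1) div p)} \<subseteq>
      (\<lambda>v. Suc (vertex_degree G v)) ` verts G"
  proof
    fix p assume "p \<in> {p. 0 < (if p = 0 then 0 else degree_count G (p - 1) div p)}"
    then have p: "p > 0" "degree_count G (p - 1) \<noteq> 0" by (auto split: if_splits intro: Nat.gr0I)
    from p(2) obtain v where "v \<in> verts G" "vertex_degree G v = p - 1"
      by (metis (mono_tags, lifting) Collect_empty_eq card.empty)
    with p(1) show "p \<in> (\<lambda>v. Suc (vertex_degree G v)) ` verts G" by force
  qed
  then have "count M = (\<lambda>p. if p = 0 then 0 else degree_count G (p - 1) div p)"
    unfolding M_def using finG finite_subset by (intro Abs_multiset_inverse) blast
  moreover obtain ps where ps: "mset ps = M" using ex_mset by blast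
  ultimately have cnt: "count (mset ps) p = (if p = 0 then 0 else degree_count G (p - 1) div p)" for p
    by simp
  have "degree_equivalent G (cliques ps)"
    using R by (simp add: degree_equivalent_iff_count[OF G simple_graph_cliques]
      degree_count_cliques cnt del: mult_Suc)
  moreover have "\<not> isomorphic G (cliques ps)"
    using cluster_if_isomorphic[OF G simple_graph_cliques cluster_cliques] R by blast
  ultimately have "G \<in> clique_degree_class ps" using G by (simp add: clique_degree_class_def)
  moreover have "\<forall>p\<in>set ps. p > 0"
    using cnt[of 0] by (metis count_mset_0_iff gr0I)
  moreover have "length ps \<ge> 1"
  proof -
    obtain v where v: "v \<in> verts G"
      using R edgeD[OF G] unfolding cluster_def by blast
    define d where "d = vertex_degree G v"
    have "degree_count G d \<noteq> 0" using v finG by (auto simp: d_def)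
    then have "count (mset ps) (Suc d) \<noteq> 0" using R dvd_imp_le[of "Suc d" "degree_count G d"]
      by (simp add: cnt div_eq_0_iff)
    then show ?thesis by (cases ps) auto
  qed
  ultimately show ?L by blast
qed

section \<open>Timed execution of straight-line code and loops\<close>

text \<open>
  The number of steps is only bounded, so that the two branches of a conditional can share one bound.
\<close>

definition reaches :: "instr list \<Rightarrow> nat \<Rightarrow> config \<Rightarrow> config \<Rightarrow> bool" where
  "reaches P t c c' \<longleftrightarrow> (\<exists>s\<le>t. (step P ^^ s) c = c')"

lemma reaches_refl: "reaches P t c c"
  unfolding reaches_def by (rule exI[of _ 0]) simp

lemma reaches_step: "reaches P 1 c (step P c)"
  unfolding reaches_def by (rule exI[of _ 1]) simp

lemma reaches_trans:
  assumes "reaches P s a b" "reaches P t b c"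
  shows "reaches P (s + t) a c"
proof -
  obtain i j where i: "i \<le> s" "(step P ^^ i) a = b" and j: "j \<le> t" "(step P ^^ j) b = c"
    using assms by (auto simp: reaches_def)
  then have "(step P ^^ (j + i)) a = c" by (simp add: funpow_add)
  with i j show ?thesis unfolding reaches_def by (intro exI[of _ "j + i"]) simp
qed

lemma reaches_mono: "reaches P s a b \<Longrightarrow> s \<le> t \<Longrightarrow> reaches P t a b"
  unfolding reaches_def using order_trans by blast

lemma answers_within_if_reaches:
  assumes "reaches P s (initial xs) c" "halted P c" "reg c 0 = (if b then 1 else 0)" "s \<le> t"
  shows "answers_within P xs t b"
proof -
  obtain i where i: "i \<le> s" "(step P ^^ i) (initial xs) = c"
    using assms(1) by (auto simp: reaches_def)
  have stay: "(step P ^^ j) c = c" for j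
    using assms(2) by (induction j) (simp_all add: step_def)
  have "(step P ^^ t) (initial xs) = (step P ^^ ((t - i) + i)) (initial xs)"
    using i(1) assms(4) by simp
  also have "\<dots> = c" unfolding funpow_add using i(2) stay by simp
  finally show ?thesis using assms(2,3) by (simp add: answers_within_def)
qed

definition code_at :: "instr list \<Rightarrow> nat \<Rightarrow> instr list \<Rightarrow> bool" where
  "code_at P l cs \<longleftrightarrow> (\<forall>i<length cs. l + i < length P \<and> P ! (l + i) = cs ! i)"

lemma code_at_self: "code_at P 0 P"
  by (simp add: code_at_def)

lemma code_at_Nil: "code_at P l []"
  by (simp add: code_at_def)

lemma code_at_Cons:
  "code_at P l (x # cs) \<longleftrightarrow> l < length P \<and> P ! l = x \<and> code_at P (Suc l) cs"
  unfolding code_at_def by (auto simp: All_less_Suc2)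

lemma code_at_append:
  "code_at P l (cs @ ds) \<longleftrightarrow> code_at P l cs \<and> code_at P (l + length cs) ds"
  by (induction cs arbitrary: l) (simp_all add: code_at_Nil code_at_Cons)

lemma step_code_at: "code_at P (pc c) (x # cs) \<Longrightarrow> step P c = exec x c"
  by (simp add: code_at_Cons step_def halted_def)

fun jump_free :: "instr \<Rightarrow> bool" where
  "jump_free (Jump l) = False"
| "jump_free (JumpZero i l) = False"
| "jump_free _ = True"

lemma pc_exec: "jump_free x \<Longrightarrow> pc (exec x c) = Suc (pc c)"
  by (cases x) simp_all

lemma reaches_straight_line:
  assumes "code_at P (pc c) cs" "list_all jump_free cs"
  shows "reaches P (length cs) c (fold exec cs c)"
  using assms
proof (induction cs arbitrary: c)
  case Nil
  then show ?case by (simp add: reaches_refl)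
next
  case (Cons x cs)
  have "reaches P 1 c (exec x c)"
    using reaches_step[of P c] step_code_at[OF Cons.prems(1)] by simp
  moreover have "reaches P (length cs) (exec x c) (fold exec cs (exec x c))"
    using Cons.prems by (intro Cons.IH) (simp_all add: code_at_Cons pc_exec)
  ultimately show ?case using reaches_trans by fastforce
qed

lemma pc_fold_exec: "list_all jump_free cs \<Longrightarrow> pc (fold exec cs c) = pc c + length cs"
  by (induction cs arbitrary: c) (simp_all add: pc_exec)

text \<open>
  The register of the answer holds \<open>0\<close> until the last instruction and doubles as the constant \<open>0\<close>.
  The registers from \<open>rTest\<close> to \<open>rW\<close> are scratch.
\<close>

abbreviation (input) rAns :: nat where "rAns \<equiv> 0"
abbreviation (input) rOne :: nat where "rOne \<equiv> 2"
abbreviation (input) rPos :: nat where "rPos \<equiv> 3"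
abbreviation (input) rDeg :: nat where "rDeg \<equiv> 4"
abbreviation (input) rTop :: nat where "rTop \<equiv> 5"
abbreviation (input) rCnt :: nat where "rCnt \<equiv> 6"
abbreviation (input) rTest :: nat where "rTest \<equiv> 7"
abbreviation (input) rU :: nat where "rU \<equiv> 8"
abbreviation (input) rV :: nat where "rV \<equiv> 9"
abbreviation (input) rX :: nat where "rX \<equiv> 10"
abbreviation (input) rY :: nat where "rY \<equiv> 11"
abbreviation (input) rZ :: nat where "rZ \<equiv> 12"
abbreviation (input) rW :: nat where "rW \<equiv> 13"
abbreviation (input) rDiff :: nat where "rDiff \<equiv> 14"
abbreviation (input) rRest :: nat where "rRest \<equiv> 15"

text \<open>
  Executes the body as long as register \<open>p\<close> is less than register \<open>q\<close>. Jump targets being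
  absolute, the code depends on the address \<open>l\<close> at which it is placed.
\<close>

definition while_less :: "nat \<Rightarrow> nat \<Rightarrow> nat \<Rightarrow> instr list \<Rightarrow> instr list" where
  "while_less l p q body =
     [Sub rTest q p, JumpZero rTest (l + length body + 3)] @ body @ [Jump l]"

text \<open>
  Invariants speak of registers and memory only, as the program counter is determined by the
  position in the loop, and must not depend on the register that evaluates the test. Each round
  costs three steps besides the body.
\<close>

lemma while_less_rule:
  fixes Inv :: "nat \<Rightarrow> (nat \<Rightarrow> nat) \<Rightarrow> (nat \<Rightarrow> nat) \<Rightarrow> bool"
  assumes code: "code_at P l (while_less l p q body)"
    and body: "\<And>i c. i < N \<Longrightarrow> Inv i (reg c) (mem c) \<Longrightarrow> pc c = l + 2 \<Longrightarrow>
        \<exists>c'. reaches P k c c' \<and> pc c' = l + 2 + length body \<and> Inv (Suc i) (reg c') (mem c')"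
    and test: "\<And>i r h. i \<le> N \<Longrightarrow> Inv i r h \<Longrightarrow> r p < r q \<longleftrightarrow> i < N"
    and scratch: "\<And>i r h y. Inv i r h \<Longrightarrow> Inv i (r(rTest := y)) h"
    and start: "pc c = l" "Inv 0 (reg c) (mem c)"
  shows "\<exists>c'. reaches P (N * (k + 3) + 2) c c' \<and> pc c' = l + length body + 3 \<and>
           Inv N (reg c') (mem c')"
proof -
  have code1: "code_at P l [Sub rTest q p]"
    and code2: "code_at P (Suc l) [JumpZero rTest (l + length body + 3)]"
    and code3: "code_at P (l + 2 + length body) [Jump l]"
    using code by (simp_all add: while_less_def code_at_append code_at_Cons code_at_Nil)
  have head: "\<exists>c'. reaches P 2 c c' \<and> Inv i (reg c') (mem c') \<and>
      pc c' = (if i < N then l + 2 else l + length body + 3)"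
    if "i \<le> N" "pc c = l" "Inv i (reg c) (mem c)" for i c
  proof -
    define c1 where "c1 = exec (Sub rTest q p) c"
    define c2 where "c2 = exec (JumpZero rTest (l + length body + 3)) c1"
    have "reaches P 1 c c1"
      using reaches_step[of P c] step_code_at[of P c] code1 that(2) by (simp add: c1_def)
    moreover have "reaches P 1 c1 c2"
      using reaches_step[of P c1] step_code_at[of P c1] code2 that(2) by (simp add: c1_def c2_def)
    ultimately have "reaches P (1 + 1) c c2" by (rule reaches_trans)
    then have "reaches P 2 c c2" by (simp only: one_add_one)
    moreover have "Inv i (reg c2) (mem c2)"
      using scratch[OF that(3)] by (simp add: c1_def c2_def)
    moreover have "pc c2 = (if i < N then l + 2 else l + length body + 3)"
      using test[OF that(1,3)] that(2) by (auto simp: c1_def c2_def)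
    ultimately show ?thesis by blast
  qed
  have round: "\<exists>c'. reaches P (i * (k + 3)) c c' \<and> pc c' = l \<and> Inv i (reg c') (mem c')"
    if "i \<le> N" for i
    using that
  proof (induction i)
    case 0
    then show ?case using start reaches_refl by auto
  next
    case (Suc i)
    then obtain c1 where c1: "reaches P (i * (k + 3)) c c1" "pc c1 = l" "Inv i (reg c1) (mem c1)"
      by auto
    then obtain c2 where c2: "reaches P 2 c1 c2" "Inv i (reg c2) (mem c2)" "pc c2 = l + 2"
      using head[of i c1] Suc.prems by auto
    then obtain c3 where c3: "reaches P k c2 c3" "pc c3 = l + 2 + length body"
        "Inv (Suc i) (reg c3) (mem c3)"
      using body[of i c2] Suc.prems by auto
    have "reaches P 1 c3 (exec (Jump l) c3)"
      using reaches_step[of P c3] step_code_at[of P c3] code3 c3(2) by simp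
    then have "reaches P (i * (k + 3) + (2 + (k + 1))) c (exec (Jump l) c3)"
      using c1(1) c2(1) c3(1) reaches_trans by blast
    then show ?case using c3(3)
      by (intro exI[of _ "exec (Jump l) c3"]) (auto elim: reaches_mono)
  qed
  obtain c1 where "reaches P (N * (k + 3)) c c1" "pc c1 = l" "Inv N (reg c1) (mem c1)"
    using round[of N] by auto
  then show ?thesis using head[of N c1] reaches_trans by fastforce
qed

section \<open>The memory as an edge list followed by three arrays\<close>

definition flat :: "(nat \<times> nat) list \<Rightarrow> nat list" where
  "flat es = concat (map (\<lambda>(u, v). [u, v]) es)"

definition edge_addr :: "nat \<Rightarrow> nat" where "edge_addr i = 2 + 2 * i"
definition deg_addr :: "(nat \<times> nat) list \<Rightarrow> nat" where "deg_addr es = edge_addr (length es)"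
definition top_addr :: "nat \<Rightarrow> (nat \<times> nat) list \<Rightarrow> nat" where "top_addr n es = deg_addr es + n"
definition cnt_addr :: "nat \<Rightarrow> (nat \<times> nat) list \<Rightarrow> nat" where "cnt_addr n es = top_addr n es + n"

text \<open>
  With \<open>m\<close> edges, the input occupies the addresses below \<open>2 + 2 * m\<close>. It is followed by an array \<open>D\<close>
  of length \<open>n\<close> for the degrees, an array \<open>M\<close> of length \<open>n\<close> for the largest members of the
  closed neighbourhoods, and an
  array \<open>C\<close> of counters. The last one takes all remaining addresses, so that it can be indexed by any
  degree. In this form each access to memory is a lookup or an update of one of the three
  functions, so that the effect of a block of code is found by rewriting.
\<close>

definition heap ::
    "nat \<Rightarrow> (nat \<times> nat) list \<Rightarrow> (nat \<Rightarrow> nat) \<Rightarrow> (nat \<Rightarrow> nat) \<Rightarrow> (nat \<Rightarrow> nat) \<Rightarrow> nat \<Rightarrow> nat" where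
  "heap n es D M C a =
     (if a < deg_addr es then (n # length es # flat es) ! a
      else if a < top_addr n es then D (a - deg_addr es)
      else if a < cnt_addr n es then M (a - top_addr n es)
      else C (a - cnt_addr n es))"

lemma length_flat: "length (flat es) = 2 * length es"
  by (induction es) (auto simp: flat_def)

lemma flat_nth:
  "i < length es \<Longrightarrow> flat es ! (2 * i) = fst (es ! i)"
  "i < length es \<Longrightarrow> flat es ! Suc (2 * i) = snd (es ! i)"
proof (induction es arbitrary: i)
  case (Cons e es)
  { case 1 then show ?case using Cons.IH(1)[of "i - 1"]
      by (cases i) (auto simp: flat_def split: prod.splits) }
  { case 2 then show ?case using Cons.IH(2)[of "i - 1"]
      by (cases i) (auto simp: flat_def split: prod.splits) }
qed simp_all

lemma initial_heap:
  "initial (n # length es # flat es) =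
     \<lparr>pc = 0, reg = \<lambda>_. 0, mem = heap n es (\<lambda>_. 0) (\<lambda>_. 0) (\<lambda>_. 0)\<rparr>"
  by (auto simp: initial_def heap_def deg_addr_def edge_addr_def length_flat)

lemma heap_header: "heap n es D M C 0 = n" "heap n es D M C (Suc 0) = length es"
  by (simp_all add: heap_def deg_addr_def edge_addr_def)

lemma heap_edge:
  assumes "i < length es"
  shows "heap n es D M C (edge_addr i) = fst (es ! i)"
    and "heap n es D M C (Suc (edge_addr i)) = snd (es ! i)"
  using assms by (simp_all add: heap_def deg_addr_def edge_addr_def flat_nth)

lemma edge_addr_Suc: "Suc (Suc (edge_addr i)) = edge_addr (Suc i)"
  by (simp add: edge_addr_def)

lemma edge_addr_less: "edge_addr i < deg_addr es \<longleftrightarrow> i < length es"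
  by (simp add: edge_addr_def deg_addr_def)

lemma heap_lookup:
  "v < n \<Longrightarrow> heap n es D M C (deg_addr es + v) = D v"
  "v < n \<Longrightarrow> heap n es D M C (top_addr n es + v) = M v"
  "heap n es D M C (cnt_addr n es + d) = C d"
  by (simp_all add: heap_def top_addr_def cnt_addr_def)

lemma heap_update:
  "v < n \<Longrightarrow> (heap n es D M C)(deg_addr es + v := x) = heap n es (D(v := x)) M C"
  "v < n \<Longrightarrow> (heap n es D M C)(top_addr n es + v := x) = heap n es D (M(v := x)) C"
  "(heap n es D M C)(cnt_addr n es + d := x) = heap n es D M (C(d := x))"
  by (auto simp: fun_eq_iff heap_def top_addr_def cnt_addr_def)

definition layout :: "nat \<Rightarrow> (nat \<times> nat) list \<Rightarrow> (nat \<Rightarrow> nat) \<Rightarrow> bool" where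
  "layout n es r \<longleftrightarrow> r rAns = 0 \<and> r rOne = 1 \<and> r rDeg = deg_addr es \<and>
     r rTop = top_addr n es \<and> r rCnt = cnt_addr n es"

section \<open>The quantities computed from the edge list\<close>

definition deg_in :: "(nat \<times> nat) list \<Rightarrow> nat \<Rightarrow> nat" where
  "deg_in es x = length (filter (\<lambda>(u, v). x = u \<or> x = v) es)"

text \<open>
  The set contains \<open>x\<close> itself as soon as \<open>x\<close> has an edge; then \<open>top_in es x\<close> is the largest member of
  the closed neighbourhood of \<open>x\<close>. Isolated vertices get \<open>0\<close>, the initial value of the memory, and
  are never compared with anything.
\<close>

definition top_in :: "(nat \<times> nat) list \<Rightarrow> nat \<Rightarrow> nat" where
  "top_in es x = Max (insert 0 (\<Union>(u, v)\<in>set es. if x = u \<or> x = v then {u, v} else {}))"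

lemma deg_in_Nil: "deg_in [] = (\<lambda>_. 0)" and top_in_Nil: "top_in [] = (\<lambda>_. 0)"
  by (simp_all add: fun_eq_iff deg_in_def top_in_def)

lemma deg_in_snoc:
  "u \<noteq> v \<Longrightarrow> deg_in (es @ [(u, v)]) =
     (deg_in es)(u := Suc (deg_in es u), v := Suc (deg_in es v))"
  by (auto simp: deg_in_def)

lemma top_in_snoc:
  "top_in (es @ [(u, v)]) =
     (top_in es)(u := max (top_in es u) (max u v), v := max (top_in es v) (max u v))"
proof
  fix x
  define A where "A = (\<Union>(u, v)\<in>set es. if x = u \<or> x = v then {u, v} else {})"
  have "finite A" by (auto simp: A_def)
  then have "Max (insert 0 (A \<union> {u, v})) = max (Max (insert 0 A)) (max u v)"
    by (cases "A = {}") (simp_all add: Max_Un max.commute max.left_commute)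
  then show "top_in (es @ [(u, v)]) x =
      ((top_in es)(u := max (top_in es u) (max u v), v := max (top_in es v) (max u v))) x"
    by (auto simp: top_in_def A_def Un_commute insert_commute)
qed

text \<open>
  The distance of two numbers, in terms of truncated subtraction.
\<close>

definition gap :: "nat \<Rightarrow> nat \<Rightarrow> nat" where
  "gap a b = (a - b) + (b - a)"

lemma gap_eq_0_iff: "gap a b = 0 \<longleftrightarrow> a = b"
  by (auto simp: gap_def)

definition mismatch :: "(nat \<Rightarrow> nat) \<Rightarrow> (nat \<Rightarrow> nat) \<Rightarrow> (nat \<times> nat) list \<Rightarrow> nat" where
  "mismatch D M es = (\<Sum>(u, v)\<leftarrow>es. gap (D u) (D v) + gap (M u) (M v))"

lemma mismatch_eq_0_iff: "mismatch D M es = 0 \<longleftrightarrow> (\<forall>(u, v)\<in>set es. D u = D v \<and> M u = M v)"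
  by (auto simp: mismatch_def gap_eq_0_iff)

lemma max_by_subtraction: "(a::nat) + (b - a) = max a b"
  by simp

definition residue :: "(nat \<Rightarrow> nat) \<Rightarrow> nat \<Rightarrow> nat \<Rightarrow> nat" where
  "residue D i d = card {v. v < i \<and> D v = d} mod Suc d"

lemma residue_0: "residue D 0 = (\<lambda>_. 0)"
  by (simp add: residue_def fun_eq_iff)

text \<open>
  A counter modulo \<open>d + 1\<close> advances by counting up and returning to \<open>0\<close> in place of \<open>d + 1\<close>.
\<close>

lemma residue_Suc:
  "residue D (Suc i) =
     (residue D i)(D i := if residue D i (D i) = D i then 0 else Suc (residue D i (D i)))"
proof
  fix d
  have "{v. v < Suc i \<and> D v = d} =
      (if D i = d then insert i {v. v < i \<and> D v = d} else {v. v < i \<and> D v = d})"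
    by (auto simp: less_Suc_eq)
  then have "card {v. v < Suc i \<and> D v = d} =
      (if D i = d then Suc (card {v. v < i \<and> D v = d}) else card {v. v < i \<and> D v = d})"
    by simp
  then show "residue D (Suc i) d =
     ((residue D i)(D i := if residue D i (D i) = D i then 0 else Suc (residue D i (D i)))) d"
    by (auto simp: residue_def mod_Suc)
qed

text \<open>
  Keeping the sum of the counters up to date saves a further pass that would inspect all of them.
  Only degrees that occur contribute.
\<close>

definition total_residue :: "(nat \<Rightarrow> nat) \<Rightarrow> nat \<Rightarrow> nat \<Rightarrow> nat" where
  "total_residue D n i = (\<Sum>d\<in>D ` {..<n}. residue D i d)"

lemma total_residue_Suc:
  assumes "i < n"
  shows "total_residue D n (Suc i) =
    (if residue D i (D i) = D i then total_residue D n i - D i else Suc (total_residue D n i))"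
proof -
  have fin: "finite (D ` {..<n})" and mem: "D i \<in> D ` {..<n}" using assms by auto
  have "(\<Sum>d\<in>D ` {..<n} - {D i}. residue D (Suc i) d) = (\<Sum>d\<in>D ` {..<n} - {D i}. residue D i d)"
    by (intro sum.cong) (auto simp: residue_Suc)
  then show ?thesis
    unfolding total_residue_def sum.remove[OF fin mem] by (simp add: residue_Suc)
qed

lemma total_residue_eq_0_iff:
  "total_residue D n n = 0 \<longleftrightarrow> (\<forall>d. Suc d dvd card {v. v < n \<and> D v = d})"
proof -
  have "residue D n d = 0" if "d \<notin> D ` {..<n}" for d
  proof -
    have "{v. v < n \<and> D v = d} = {}" using that by auto
    then show ?thesis by (simp only: residue_def card.empty mod_0)
  qed
  moreover have "total_residue D n n = 0 \<longleftrightarrow> (\<forall>d\<in>D ` {..<n}. residue D n d = 0)"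
    by (simp add: total_residue_def)
  ultimately have "total_residue D n n = 0 \<longleftrightarrow> (\<forall>d. residue D n d = 0)" by metis
  then show ?thesis by (simp add: residue_def dvd_eq_mod_eq_0)
qed

section \<open>The program\<close>

text \<open>
  At the two loads, \<open>rAns\<close> and \<open>rOne\<close> hold \<open>0\<close> and \<open>1\<close>, the addresses of \<open>n\<close> and \<open>m\<close>. Register
  \<open>rPos\<close> is set to \<open>2\<close>, where the edges begin.
\<close>

definition prologue :: "instr list" where
  "prologue =
     [Const rOne 1, Load rX rAns, Load rDeg rOne, Add rDeg rDeg rDeg, Add rDeg rDeg rOne,
      Add rDeg rDeg rOne, Add rTop rDeg rX, Add rCnt rTop rX, Add rPos rOne rOne]"

definition read_edge :: "instr list" where
  "read_edge = [Load rU rPos, Add rPos rPos rOne, Load rV rPos, Add rPos rPos rOne]"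

definition bump_degree :: "nat \<Rightarrow> instr list" where
  "bump_degree a = [Add rX rDeg a, Load rY rX, Add rY rY rOne, Store rX rY]"

definition raise_top :: "nat \<Rightarrow> instr list" where
  "raise_top a = [Add rX rTop a, Load rY rX, Sub rW rZ rY, Add rY rY rW, Store rX rY]"

text \<open>
  Register \<open>rZ\<close> receives the larger end of the edge, computed without a branch as \<open>u + (v - u)\<close>. The
  entry of each end is then raised to at least this value in the same way. As both ends of the edge
  take part, the vertex itself is included in the maximum.
\<close>

definition record_edge :: "instr list" where
  "record_edge =
     read_edge @ [Sub rZ rV rU, Add rZ rU rZ] @
     bump_degree rU @ bump_degree rV @ raise_top rU @ raise_top rV"

definition add_gap :: "nat \<Rightarrow> instr list" where
  "add_gap base =
     [Add rX base rU, Load rX rX, Add rY base rV, Load rY rY,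
      Sub rZ rX rY, Sub rW rY rX, Add rZ rZ rW, Add rDiff rDiff rZ]"

definition compare_ends :: "instr list" where
  "compare_ends = read_edge @ add_gap rDeg @ add_gap rTop"

text \<open>
  Register \<open>rZ\<close> becomes \<open>1\<close> if the counter of the current degree stood at its largest value, the
  degree itself, and \<open>0\<close> otherwise. The counter and the sum of all counters are advanced in any case.
\<close>

definition count_degree :: "instr list" where
  "count_degree =
     [Load rU rPos, Add rPos rPos rOne, Add rX rCnt rU, Load rY rX, Sub rZ rU rY, Sub rZ rOne rZ,
      Add rY rY rOne, Store rX rY, Add rRest rRest rOne]"

text \<open>
  Undoes an overflow: the counter, which has just reached \<open>d + 1\<close>, returns to \<open>0\<close>.
\<close>

definition reset_count :: "instr list" where
  "reset_count = [Store rX rAns, Sub rRest rRest rU, Sub rRest rRest rOne]"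

definition tally_vertex :: "nat \<Rightarrow> instr list" where
  "tally_vertex l =
     count_degree @ [JumpZero rZ (l + length count_degree + 1 + length reset_count)] @ reset_count"

text \<open>
  For natural numbers \<open>(1 - r) - (1 - f)\<close> is \<open>1\<close> if \<open>r = 0\<close> and \<open>f > 0\<close>, and \<open>0\<close> otherwise.
\<close>

definition verdict :: "instr list" where
  "verdict = [Sub rX rOne rRest, Sub rY rOne rDiff, Sub rAns rX rY]"

text \<open>
  The numbers are the addresses at which the loops and the body of the last one begin. That loop
  starts where the second one leaves the pointer, at the end of the edge list, which is the
  beginning of the array of degrees; it ends where this array does.
\<close>

definition decider :: "instr list" where
  "decider =
     prologue @
     while_less 9 rPos rDeg record_edge @
     [Add rPos rOne rOne] @
     while_less 37 rPos rDeg compare_ends @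
     while_less 60 rPos rTop (tally_vertex 62) @
     verdict"

lemmas block_defs = prologue_def read_edge_def bump_degree_def raise_top_def record_edge_def
  add_gap_def compare_ends_def count_degree_def reset_count_def tally_vertex_def verdict_def

lemma block_length:
  "length prologue = 9" "length record_edge = 24" "length compare_ends = 20"
  "length count_degree = 9" "length reset_count = 3" "length (tally_vertex l) = 13"
  "length verdict = 3"
  by (simp_all add: block_defs)

lemma block_jump_free:
  "list_all jump_free prologue" "list_all jump_free record_edge"
  "list_all jump_free compare_ends" "list_all jump_free count_degree"
  "list_all jump_free reset_count" "list_all jump_free verdict"
  by (simp_all add: block_defs)

lemma decider_code:
  "code_at decider 0 prologue"
  "code_at decider 9 (while_less 9 rPos rDeg record_edge)"
  "code_at decider 36 [Add rPos rOne rOne]"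
  "code_at decider 37 (while_less 37 rPos rDeg compare_ends)"
  "code_at decider 60 (while_less 60 rPos rTop (tally_vertex 62))"
  "code_at decider 76 verdict"
  "length decider = 79"
proof -
  have len: "length prologue = 9" "length (while_less 9 rPos rDeg record_edge) = 27"
    "length (while_less 37 rPos rDeg compare_ends) = 23"
    "length (while_less 60 rPos rTop (tally_vertex 62)) = 16" "length verdict = 3"
    by (simp_all add: while_less_def block_length)
  have "code_at P 0 decider \<Longrightarrow> code_at P 0 prologue \<and>
      code_at P 9 (while_less 9 rPos rDeg record_edge) \<and>
      code_at P 36 [Add rPos rOne rOne] \<and>
      code_at P 37 (while_less 37 rPos rDeg compare_ends) \<and>
      code_at P 60 (while_less 60 rPos rTop (tally_vertex 62)) \<and>
      code_at P 76 verdict" for P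
    using len by (simp add: decider_def code_at_append code_at_Cons code_at_Nil)
  with code_at_self[of decider] show
    "code_at decider 0 prologue"
    "code_at decider 9 (while_less 9 rPos rDeg record_edge)"
    "code_at decider 36 [Add rPos rOne rOne]"
    "code_at decider 37 (while_less 37 rPos rDeg compare_ends)"
    "code_at decider 60 (while_less 60 rPos rTop (tally_vertex 62))"
    "code_at decider 76 verdict"
    by blast+
  show "length decider = 79" using len by (simp add: decider_def)
qed

lemma while_less_body: "code_at P l (while_less l p q body) \<Longrightarrow> code_at P (l + 2) body"
  by (simp add: while_less_def code_at_append code_at_Cons)

section \<open>Correctness of the program\<close>

lemma record_loop:
  assumes ends: "\<And>i. i < length es \<Longrightarrow> fst (es ! i) < n \<and> snd (es ! i) < n \<and> fst (es ! i) \<noteq> snd (es ! i)"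
    and code: "code_at P l (while_less l rPos rDeg record_edge)"
    and start: "pc c = l" "layout n es (reg c)" "reg c rPos = edge_addr 0"
      "reg c rDiff = 0" "reg c rRest = 0" "mem c = heap n es (\<lambda>_. 0) (\<lambda>_. 0) (\<lambda>_. 0)"
  shows "\<exists>c'. reaches P (length es * 27 + 2) c c' \<and> pc c' = l + 27 \<and> layout n es (reg c') \<and>
           reg c' rDiff = 0 \<and> reg c' rRest = 0 \<and>
           mem c' = heap n es (deg_in es) (top_in es) (\<lambda>_. 0)"
proof -
  define Inv where "Inv i r h \<longleftrightarrow> layout n es r \<and> r rPos = edge_addr i \<and> r rDiff = 0 \<and> r rRest = 0 \<and>
      h = heap n es (deg_in (take i es)) (top_in (take i es)) (\<lambda>_. 0)"
    for i and r h :: "nat \<Rightarrow> nat"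
  have "\<exists>c'. reaches P (length es * (24 + 3) + 2) c c' \<and> pc c' = l + length record_edge + 3 \<and>
      Inv (length es) (reg c') (mem c')"
  proof (rule while_less_rule[OF code])
    fix i and c :: config assume i: "i < length es" and c: "Inv i (reg c) (mem c)" "pc c = l + 2"
    define c' where "c' = fold exec record_edge c"
    obtain u v where uv: "es ! i = (u, v)" by fastforce
    then have *: "u < n" "v < n" "u \<noteq> v" using ends[OF i] by auto
    have "reaches P 24 c c'"
      using reaches_straight_line[of P c record_edge] while_less_body[OF code] c(2)
      by (simp add: c'_def block_length block_jump_free)
    moreover have "pc c' = l + 2 + length record_edge"
      unfolding c'_def using c(2) by (simp add: pc_fold_exec block_jump_free)
    moreover have "Inv (Suc i) (reg c') (mem c')"
      using c(1) i uv *
      by (simp add: Inv_def c'_def block_defs layout_def heap_edge heap_lookup heap_update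
        edge_addr_Suc take_Suc_conv_app_nth deg_in_snoc top_in_snoc max_by_subtraction)
    ultimately show "\<exists>c'. reaches P 24 c c' \<and> pc c' = l + 2 + length record_edge \<and>
        Inv (Suc i) (reg c') (mem c')"
      by blast
  qed (use start in \<open>auto simp: Inv_def layout_def edge_addr_less deg_in_Nil top_in_Nil\<close>)
  then show ?thesis unfolding Inv_def by (auto simp: block_length add.commute)
qed

lemma compare_loop:
  assumes ends: "\<And>i. i < length es \<Longrightarrow> fst (es ! i) < n \<and> snd (es ! i) < n"
    and code: "code_at P l (while_less l rPos rDeg compare_ends)"
    and start: "pc c = l" "layout n es (reg c)" "reg c rPos = edge_addr 0"
      "reg c rDiff = 0" "reg c rRest = 0" "mem c = heap n es D M C"
  shows "\<exists>c'. reaches P (length es * 23 + 2) c c' \<and> pc c' = l + 23 \<and> layout n es (reg c') \<and>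
           reg c' rPos = deg_addr es \<and> reg c' rDiff = mismatch D M es \<and> reg c' rRest = 0 \<and>
           mem c' = heap n es D M C"
proof -
  define Inv where "Inv i r h \<longleftrightarrow> layout n es r \<and> r rPos = edge_addr i \<and>
      r rDiff = mismatch D M (take i es) \<and> r rRest = 0 \<and> h = heap n es D M C"
    for i and r h :: "nat \<Rightarrow> nat"
  have "\<exists>c'. reaches P (length es * (20 + 3) + 2) c c' \<and> pc c' = l + length compare_ends + 3 \<and>
      Inv (length es) (reg c') (mem c')"
  proof (rule while_less_rule[OF code])
    fix i and c :: config assume i: "i < length es" and c: "Inv i (reg c) (mem c)" "pc c = l + 2"
    define c' where "c' = fold exec compare_ends c"
    obtain u v where uv: "es ! i = (u, v)" by fastforce
    then have *: "u < n" "v < n" using ends[OF i] by auto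
    have "reaches P 20 c c'"
      using reaches_straight_line[of P c compare_ends] while_less_body[OF code] c(2)
      by (simp add: c'_def block_length block_jump_free)
    moreover have "pc c' = l + 2 + length compare_ends"
      unfolding c'_def using c(2) by (simp add: pc_fold_exec block_jump_free)
    moreover have "Inv (Suc i) (reg c') (mem c')"
      using c(1) i uv *
      by (simp add: Inv_def c'_def block_defs layout_def heap_edge heap_lookup
        edge_addr_Suc take_Suc_conv_app_nth mismatch_def gap_def)
    ultimately show "\<exists>c'. reaches P 20 c c' \<and> pc c' = l + 2 + length compare_ends \<and>
        Inv (Suc i) (reg c') (mem c')"
      by blast
  qed (use start in \<open>auto simp: Inv_def layout_def edge_addr_less mismatch_def\<close>)
  then show ?thesis by (simp add: Inv_def block_length deg_addr_def add.commute)
qed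

lemma tally_loop:
  assumes code: "code_at P l (while_less l rPos rTop (tally_vertex (l + 2)))"
    and start: "pc c = l" "layout n es (reg c)" "reg c rPos = deg_addr es"
      "reg c rDiff = f" "reg c rRest = 0" "mem c = heap n es D M (\<lambda>_. 0)"
  shows "\<exists>c'. reaches P (n * 16 + 2) c c' \<and> pc c' = l + 16 \<and> layout n es (reg c') \<and>
           reg c' rDiff = f \<and> reg c' rRest = total_residue D n n"
proof -
  define Inv where "Inv i r h \<longleftrightarrow> layout n es r \<and> r rPos = deg_addr es + i \<and>
      r rDiff = f \<and> r rRest = total_residue D n i \<and> h = heap n es D M (residue D i)"
    for i and r h :: "nat \<Rightarrow> nat"
  note body = while_less_body[OF code, unfolded tally_vertex_def code_at_append]
  have "\<exists>c'. reaches P (n * (13 + 3) + 2) c c' \<and> pc c' = l + length (tally_vertex (l + 2)) + 3 \<and>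
      Inv n (reg c') (mem c')"
  proof (rule while_less_rule[OF code])
    fix i and c :: config assume i: "i < n" and c: "Inv i (reg c) (mem c)" "pc c = l + 2"
    define c1 where "c1 = fold exec count_degree c"
    define c2 where "c2 = exec (JumpZero rZ (l + 2 + length count_degree + 1 + length reset_count)) c1"
    have pc1: "pc c1 = l + 2 + length count_degree"
      unfolding c1_def using c(2) by (simp add: pc_fold_exec block_jump_free)
    have r1: "reaches P 9 c c1"
      using reaches_straight_line[of P c count_degree] body c(2)
      by (simp add: c1_def block_length block_jump_free)
    have "step P c1 = c2"
      unfolding c2_def using body by (intro step_code_at[where cs = "[]"]) (simp add: pc1)
    then have "reaches P 1 c1 c2" using reaches_step[of P c1] by simp
    with r1 have r2: "reaches P (9 + 1) c c2" by (rule reaches_trans)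
    have s1: "layout n es (reg c1)" "reg c1 rPos = deg_addr es + Suc i" "reg c1 rDiff = f"
      "reg c1 rRest = Suc (total_residue D n i)" "reg c1 rU = D i"
      "reg c1 rX = cnt_addr n es + D i" "reg c1 rZ = 1 - (D i - residue D i (D i))"
      "mem c1 = heap n es D M ((residue D i)(D i := Suc (residue D i (D i))))"
      using c(1) i by (simp_all add: Inv_def c1_def block_defs layout_def heap_lookup heap_update)
    have le: "residue D i (D i) \<le> D i"
      unfolding residue_def using mod_less_divisor[of "Suc (D i)"] by (simp add: less_Suc_eq_le)
    \<comment> \<open>The conditional jump skips the reset unless the counter overflows.\<close>
    show "\<exists>c'. reaches P 13 c c' \<and> pc c' = l + 2 + length (tally_vertex (l + 2)) \<and>
        Inv (Suc i) (reg c') (mem c')"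
    proof (cases "residue D i (D i) = D i")
      case False
      with le s1(7) have "reg c1 rZ = 0" by simp
      then have "pc c2 = l + 2 + length (tally_vertex (l + 2))" "reg c2 = reg c1" "mem c2 = mem c1"
        by (simp_all add: c2_def tally_vertex_def)
      moreover have "Inv (Suc i) (reg c1) (mem c1)"
        using s1 False i by (simp add: Inv_def total_residue_Suc residue_Suc)
      moreover have "reaches P 13 c c2" using r2 by (rule reaches_mono) simp
      ultimately show ?thesis by (intro exI[of _ c2]) simp
    next
      case True
      define c3 where "c3 = fold exec reset_count c2"
      have "reg c1 rZ = 1" using True s1(7) by simp
      then have c2: "pc c2 = l + 2 + length count_degree + 1" "reg c2 = reg c1" "mem c2 = mem c1"
        by (simp_all add: c2_def pc1)
      have "reaches P 3 c2 c3"
        using reaches_straight_line[of P c2 reset_count] body c2(1)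
        by (simp add: c3_def block_length block_jump_free)
      with r2 have "reaches P (9 + 1 + 3) c c3" by (rule reaches_trans)
      moreover have "pc c3 = l + 2 + length (tally_vertex (l + 2))"
        unfolding c3_def using c2(1) by (simp add: pc_fold_exec block_jump_free block_length)
      moreover have "Inv (Suc i) (reg c3) (mem c3)"
        using s1 c2 True i
        by (simp add: Inv_def c3_def reset_count_def layout_def heap_update total_residue_Suc
          residue_Suc)
      ultimately show ?thesis by (auto elim: reaches_mono)
    qed
  qed (use start in \<open>auto simp: Inv_def layout_def top_addr_def residue_0 total_residue_def\<close>)
  then show ?thesis unfolding Inv_def by (auto simp: block_length add.commute)
qed

text \<open>
  The loops take \<open>27\<close> and \<open>23\<close> steps per edge and \<open>16\<close> per vertex; all other steps together are
  at most \<open>19\<close>.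
\<close>

lemma decider_correct:
  assumes ends: "\<And>u v. (u, v) \<in> set es \<Longrightarrow> u < n \<and> v < n \<and> u \<noteq> v"
  shows "answers_within decider (n # length es # flat es) (50 * (n + length es + 1))
    ((\<forall>d. Suc d dvd card {v. v < n \<and> deg_in es v = d}) \<and>
     \<not> (\<forall>(u, v)\<in>set es. deg_in es u = deg_in es v \<and> top_in es u = top_in es v))"
proof -
  have ends': "fst (es ! i) < n \<and> snd (es ! i) < n \<and> fst (es ! i) \<noteq> snd (es ! i)" if "i < length es" for i
    using ends[of "fst (es ! i)" "snd (es ! i)"] that by simp
  define c0 where "c0 = initial (n # length es # flat es)"
  define c1 where "c1 = fold exec prologue c0"
  have c0: "pc c0 = 0" "reg c0 = (\<lambda>_. 0)" "mem c0 = heap n es (\<lambda>_. 0) (\<lambda>_. 0) (\<lambda>_. 0)"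
    by (simp_all add: c0_def initial_heap)
  have r1: "reaches decider 9 c0 c1"
    using reaches_straight_line[of decider c0 prologue] decider_code(1)
    by (simp add: c0 c1_def block_length block_jump_free)
  have c1: "pc c1 = 9" "layout n es (reg c1)" "reg c1 rPos = edge_addr 0"
      "reg c1 rDiff = 0" "reg c1 rRest = 0" "mem c1 = heap n es (\<lambda>_. 0) (\<lambda>_. 0) (\<lambda>_. 0)"
    by (simp_all add: c1_def c0 block_defs layout_def heap_header deg_addr_def edge_addr_def
      top_addr_def cnt_addr_def)
  obtain c2 where r2: "reaches decider (length es * 27 + 2) c1 c2"
    and c2: "pc c2 = 36" "layout n es (reg c2)" "reg c2 rDiff = 0" "reg c2 rRest = 0"
      "mem c2 = heap n es (deg_in es) (top_in es) (\<lambda>_. 0)"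
    using record_loop[OF ends' decider_code(2) c1] by auto
  define c3 where "c3 = exec (Add rPos rOne rOne) c2"
  have r3: "reaches decider 1 c2 c3"
    using reaches_step[of decider c2] step_code_at[of decider c2] decider_code(3) c2(1)
    by (simp add: c3_def)
  have c3: "pc c3 = 37" "layout n es (reg c3)" "reg c3 rPos = edge_addr 0" "reg c3 rDiff = 0"
      "reg c3 rRest = 0" "mem c3 = heap n es (deg_in es) (top_in es) (\<lambda>_. 0)"
    using c2 by (simp_all add: c3_def layout_def edge_addr_def)
  obtain c4 where r4: "reaches decider (length es * 23 + 2) c3 c4"
    and c4: "pc c4 = 60" "layout n es (reg c4)" "reg c4 rPos = deg_addr es"
      "reg c4 rDiff = mismatch (deg_in es) (top_in es) es" "reg c4 rRest = 0"
      "mem c4 = heap n es (deg_in es) (top_in es) (\<lambda>_. 0)"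
    using compare_loop[OF _ decider_code(4) c3] ends' by auto
  obtain c5 where r5: "reaches decider (n * 16 + 2) c4 c5"
    and c5: "pc c5 = 76" "layout n es (reg c5)"
      "reg c5 rDiff = mismatch (deg_in es) (top_in es) es"
      "reg c5 rRest = total_residue (deg_in es) n n"
    using tally_loop[OF _ c4] decider_code(5) by auto
  define c6 where "c6 = fold exec verdict c5"
  have r6: "reaches decider 3 c5 c6"
    using reaches_straight_line[of decider c5 verdict] decider_code(6) c5(1)
    by (simp add: c6_def block_length block_jump_free)
  have pc6: "halted decider c6"
    using c5(1) by (simp add: c6_def verdict_def halted_def decider_code(7))
  have ans: "reg c6 0 = (if total_residue (deg_in es) n n = 0 \<and>
      mismatch (deg_in es) (top_in es) es \<noteq> 0 then 1 else 0)"
    using c5 by (simp add: c6_def verdict_def layout_def)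
  have "reaches decider (9 + ((length es * 27 + 2) + (1 + ((length es * 23 + 2) + ((n * 16 + 2) + 3)))))
      c0 c6"
    by (intro reaches_trans[OF r1] reaches_trans[OF r2] reaches_trans[OF r3]
      reaches_trans[OF r4] reaches_trans[OF r5] r6)
  then show ?thesis
    unfolding c0_def
    by (rule answers_within_if_reaches)
      (use pc6 ans in \<open>simp_all add: total_residue_eq_0_iff mismatch_eq_0_iff\<close>)
qed

section \<open>Reading the answer off the encoded graph\<close>

locale encoding =
  fixes G :: "'a graph" and f :: "'a \<Rightarrow> nat" and n :: nat and es :: "(nat \<times> nat) list"
  assumes G: "simple_graph G"
    and f: "bij_betw f (verts G) {0..<n}"
    and distinct_edges: "distinct (map (\<lambda>(u, v). {u, v}) es)"
    and set_edges: "set (map (\<lambda>(u, v). {u, v}) es) = (\<lambda>e. f ` e) ` edges G"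
begin

lemma inj: "inj_on f (verts G)"
  using f by (simp add: bij_betw_def)

lemma listed_edgeE:
  assumes "(a, b) \<in> set es"
  obtains u v where "{u, v} \<in> edges G" "a = f u" "b = f v" "u \<in> verts G" "v \<in> verts G" "u \<noteq> v"
proof -
  have "{a, b} \<in> (\<lambda>e. f ` e) ` edges G" unfolding set_edges[symmetric] using assms by force
  then obtain e where e: "e \<in> edges G" "{a, b} = f ` e" by blast
  obtain u v where uv: "e = {u, v}" "u \<noteq> v" "u \<in> verts G" "v \<in> verts G"
    using edge_cases[OF G e(1)] by blast
  with e(2) have "a = f u \<and> b = f v \<or> a = f v \<and> b = f u" by (simp add: doubleton_eq_iff)
  with that[of u v] that[of v u] uv e(1) show thesis by (auto simp: insert_commute)
qed

lemma edge_listed: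
  assumes "{u, v} \<in> edges G"
  shows "(f u, f v) \<in> set es \<or> (f v, f u) \<in> set es"
proof -
  have "{f u, f v} \<in> set (map (\<lambda>(u, v). {u, v}) es)"
    unfolding set_edges using assms by (intro image_eqI[of _ _ "{u, v}"]) simp_all
  then show ?thesis by (auto simp: doubleton_eq_iff)
qed

lemma ends_bounded: "(a, b) \<in> set es \<Longrightarrow> a < n \<and> b < n \<and> a \<noteq> b"
  using f inj by (elim listed_edgeE) (auto simp: bij_betw_def inj_on_def)

lemma inj_image: "inj_on ((`) f) (edges G)"
  using G inj by (intro inj_on_image inj_on_subset[OF inj]) (auto simp: simple_graph_def)

lemma length_edges: "length es = card (edges G)"
  using distinct_card[OF distinct_edges] unfolding set_edges by (simp add: card_image[OF inj_image])

lemma deg_in_label: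
  assumes v: "v \<in> verts G"
  shows "deg_in es (f v) = vertex_degree G v"
proof -
  let ?h = "\<lambda>(u, v). {u, v}" and ?S = "filter (\<lambda>(a, b). f v = a \<or> f v = b) es"
  have d: "distinct es" "inj_on ?h (set es)" using distinct_edges by (simp_all add: distinct_map)
  have "deg_in es (f v) = card (set ?S)"
    unfolding deg_in_def using d(1) by (subst distinct_card) simp_all
  also have "\<dots> = card (?h ` set ?S)"
    using d(2) by (intro card_image[symmetric] inj_on_subset[OF d(2)]) auto
  also have "?h ` set ?S = {e' \<in> set (map ?h es). f v \<in> e'}" by auto
  also have "\<dots> = (`) f ` {e \<in> edges G. v \<in> e}"
  proof -
    have "f v \<in> f ` e \<longleftrightarrow> v \<in> e" if "e \<in> edges G" for e
      using G inj v that by (intro inj_on_image_mem_iff) (auto simp: simple_graph_def)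
    then show ?thesis unfolding set_edges by auto
  qed
  also have "card \<dots> = vertex_degree G v"
    unfolding vertex_degree_def by (intro card_image inj_on_subset[OF inj_image]) auto
  finally show ?thesis .
qed

lemma top_in_label:
  assumes vw: "{v, w} \<in> edges G"
  shows "top_in es (f v) = Max (f ` closed_nbhd G v)"
proof -
  let ?A = "\<Union>(a, b)\<in>set es. if f v = a \<or> f v = b then {a, b} else {}"
  note v = edgeD(1)[OF G vw]
  have "?A = f ` closed_nbhd G v"
  proof
    show "?A \<subseteq> f ` closed_nbhd G v"
    proof
      fix x assume "x \<in> ?A"
      then obtain a b where ab: "(a, b) \<in> set es" "f v = a \<or> f v = b" "x = a \<or> x = b"
        by (auto split: if_splits)
      from ab(1) obtain y z where yz: "{y, z} \<in> edges G" "a = f y" "b = f z"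
          "y \<in> verts G" "z \<in> verts G"
        by (rule listed_edgeE)
      with ab(2) v inj have "v = y \<or> v = z" by (auto dest: inj_onD)
      with yz ab(3) show "x \<in> f ` closed_nbhd G v"
        by (auto simp: closed_nbhd_def insert_commute)
    qed
    have "f u \<in> ?A" if "u \<in> closed_nbhd G v" for u
    proof -
      have "\<exists>y. {y, v} \<in> edges G \<and> (u = v \<or> u = y)"
      proof (cases "u = v")
        case True
        then show ?thesis using vw by (intro exI[of _ w]) (simp add: insert_commute)
      next
        case False
        then show ?thesis using that by (simp add: closed_nbhd_def)
      qed
      then obtain y where y: "{y, v} \<in> edges G" "u = v \<or> u = y" by blast
      then show ?thesis using edge_listed[OF y(1)] by force
    qed
    then show "f ` closed_nbhd G v \<subseteq> ?A" by blast
  qed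
  moreover have "Max (insert 0 (f ` closed_nbhd G v)) = Max (f ` closed_nbhd G v)"
    using finite_closed_nbhd[OF G v] by (subst Max_insert) (auto simp: closed_nbhd_def)
  ultimately show ?thesis unfolding top_in_def by simp
qed

text \<open>
  Only vertices on an edge are compared, and for these \<open>top_in\<close> is the maximum in the local test.
\<close>

lemma cluster_iff_listed:
  "cluster G \<longleftrightarrow> (\<forall>(a, b)\<in>set es. deg_in es a = deg_in es b \<and> top_in es a = top_in es b)"
proof -
  have lab: "deg_in es (f u) = vertex_degree G u" "deg_in es (f v) = vertex_degree G v"
      "top_in es (f u) = Max (f ` closed_nbhd G u)" "top_in es (f v) = Max (f ` closed_nbhd G v)"
    if "{u, v} \<in> edges G" for u v
    using that edgeD[OF G that] deg_in_label top_in_label[of u v] top_in_label[of v u]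
    by (simp_all add: insert_commute)
  show ?thesis
    unfolding cluster_iff_local_test[OF G inj]
  proof safe
    fix a b
    assume *: "\<forall>u v. {u, v} \<in> edges G \<longrightarrow> vertex_degree G u = vertex_degree G v \<and>
        Max (f ` closed_nbhd G u) = Max (f ` closed_nbhd G v)"
    assume "(a, b) \<in> set es"
    then obtain u v where "{u, v} \<in> edges G" "a = f u" "b = f v" by (rule listed_edgeE)
    with * lab show "deg_in es a = deg_in es b" "top_in es a = top_in es b" by simp_all
  next
    fix u v
    assume *: "\<forall>(a, b)\<in>set es. deg_in es a = deg_in es b \<and> top_in es a = top_in es b"
      and uv: "{u, v} \<in> edges G"
    from * edge_listed[OF uv] lab[OF uv] show "vertex_degree G u = vertex_degree G v"
      and "Max (f ` closed_nbhd G u) = Max (f ` closed_nbhd G v)"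
      by force+
  qed
qed

lemma degree_count_listed: "card {x. x < n \<and> deg_in es x = d} = degree_count G d"
proof -
  have "{x. x < n \<and> deg_in es x = d} = f ` {v \<in> verts G. vertex_degree G v = d}"
  proof -
    have "{x. x < n} = f ` verts G" using f by (auto simp: bij_betw_def)
    then have "{x. x < n \<and> deg_in es x = d} = {x \<in> f ` verts G. deg_in es x = d}" by auto
    also have "\<dots> = f ` {v \<in> verts G. vertex_degree G v = d}" using deg_in_label by auto
    finally show ?thesis .
  qed
  then show ?thesis using card_image[OF inj_on_subset[OF inj]] by simp
qed

end

theorem proposition1:
  "\<exists>P. decides_in_linear_time P
     (\<lambda>G. \<exists>ps. length ps \<ge> 1 \<and> (\<forall>p\<in>set ps. p > 0) \<and> G \<in> clique_degree_class ps)"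
  unfolding decides_in_linear_time_def
proof (intro exI allI impI)
  fix G :: "nat graph" and xs
  assume G: "simple_graph G" and "encodes xs G"
  then obtain f es where f: "bij_betw f (verts G) {0..<card (verts G)}"
    and es: "distinct (map (\<lambda>(u, v). {u, v}) es)"
      "set (map (\<lambda>(u, v). {u, v}) es) = (\<lambda>e. f ` e) ` edges G"
    and xs: "xs = card (verts G) # length es # flat es"
    unfolding encodes_def flat_def by blast
  interpret encoding G f "card (verts G)" es
    using G f es by unfold_locales
  show "answers_within decider xs (50 * (card (verts G) + card (edges G) + 1))
      (\<exists>ps. length ps \<ge> 1 \<and> (\<forall>p\<in>set ps. p > 0) \<and> G \<in> clique_degree_class ps)"
    using decider_correct[of es "card (verts G)", OF ends_bounded]
    unfolding in_clique_degree_class_iff[OF G] degree_count_listed cluster_iff_listed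
      length_edges[symmetric] xs .
qed

end
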